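(* $\mathsf{add}\left(\binom{\mathcal{B}_\mathrm{T}}{\mathcal{B}_\Gamma}\right)=\mathsf{add}\left(\binom{\mathrm{T}}{\Gamma}\right)=\mathfrak{t}$.
   Context: All spaces $X$ are infinite sets of reals; all covers considered are assumed not to contain $X$ as a member. A cover is a $\gamma$-cover of $X$ if it is infinite and each point lies in all but finitely many members; large if each point lies in infinitely many members. A large cover $\mathcal{U}$ is a $\tau$-cover if for all $x,y\in X$, either ($x\in U\Rightarrow y\in U$) for all but finitely many $U\in\mathcal{U}$, or ($y\in U\Rightarrow x\in U$) for all but finitely many $U\in\mathcal{U}$. $\Gamma,\mathrm{T}$ are the collections of countable open $\gamma$-, $\tau$-covers; $\mathcal{B}_\Gamma,\mathcal{B}_\mathrm{T}$ their countable Borel analogues. $X$ satisfies $\binom{\mathfrak{U}}{\mathfrak{V}}$ if every $\mathcal{U}\in\mathfrak{U}$ has a subcollection belonging to $\mathfrak{V}$. For a class $\mathcal{J}$ of sets of reals, $\mathsf{add}(\mathcal{J})$ is the minimal cardinality of a collection $\mathcal{F}\subseteq\mathcal{J}$ with $\bigcup\mathcal{F}\notin\mathcal{J}$. $\mathfrak{t}$ is the minimal size of a tower: a family of infinite subsets of $\mathbb{N}$ linearly quasiordered by $\subseteq^*$ ($a\subseteq^*b$ iff $a\setminus b$ finite) with no infinite $a\subseteq\mathbb{N}$ such that $a\subseteq^*b$ for all its members $b$. *)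

theory Defs
  imports "HOL-Analysis.Analysis"
begin

unbundle cardinal_syntax

text \<open>
  Covers of \<open>X\<close> consist of subsets of \<open>X\<close>, where \<open>X\<close> is regarded as a space in its own right.
  Hence the members of open covers are relatively open in \<open>X\<close>, and the condition that \<open>X\<close> is
  not a member is about traces on \<open>X\<close>.
\<close>

definition cover :: "'a set \<Rightarrow> 'a set set \<Rightarrow> bool" where
  "cover X \<U> \<longleftrightarrow> \<Union>\<U> = X \<and> X \<notin> \<U>"

definition gamma_cover :: "'a set \<Rightarrow> 'a set set \<Rightarrow> bool" where
  "gamma_cover X \<U> \<longleftrightarrow> cover X \<U> \<and> infinite \<U> \<and> (\<forall>x\<in>X. finite {U\<in>\<U>. x \<notin> U})"

definition large_cover :: "'a set \<Rightarrow> 'a set set \<Rightarrow> bool" where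
  "large_cover X \<U> \<longleftrightarrow> cover X \<U> \<and> (\<forall>x\<in>X. infinite {U\<in>\<U>. x \<in> U})"

definition tau_cover :: "'a set \<Rightarrow> 'a set set \<Rightarrow> bool" where
  "tau_cover X \<U> \<longleftrightarrow> large_cover X \<U> \<and>
     (\<forall>x\<in>X. \<forall>y\<in>X. finite {U\<in>\<U>. \<not> (x \<in> U \<longrightarrow> y \<in> U)} \<or> finite {U\<in>\<U>. \<not> (y \<in> U \<longrightarrow> x \<in> U)})"

definition Open_Gamma :: "real set \<Rightarrow> real set set set" where
  "Open_Gamma X = {\<U>. countable \<U> \<and> (\<forall>U\<in>\<U>. openin (top_of_set X) U) \<and> gamma_cover X \<U>}"

definition Open_Tau :: "real set \<Rightarrow> real set set set" where
  "Open_Tau X = {\<U>. countable \<U> \<and> (\<forall>U\<in>\<U>. openin (top_of_set X) U) \<and> tau_cover X \<U>}"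

definition Borel_Gamma :: "real set \<Rightarrow> real set set set" where
  "Borel_Gamma X = {\<U>. countable \<U> \<and> (\<forall>U\<in>\<U>. U \<in> sets (restrict_space borel X)) \<and> gamma_cover X \<U>}"

definition Borel_Tau :: "real set \<Rightarrow> real set set set" where
  "Borel_Tau X = {\<U>. countable \<U> \<and> (\<forall>U\<in>\<U>. U \<in> sets (restrict_space borel X)) \<and> tau_cover X \<U>}"

text \<open>The class of all spaces, i.e. infinite sets of reals, with the binomial covering property.\<close>

definition cov_binom ::
  "(real set \<Rightarrow> real set set set) \<Rightarrow> (real set \<Rightarrow> real set set set) \<Rightarrow> real set set" where
  "cov_binom \<A> \<B> = {X. infinite X \<and> (\<forall>\<U>\<in>\<A> X. \<exists>\<V>. \<V> \<subseteq> \<U> \<and> \<V> \<in> \<B> X)}"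

text \<open>
  The minimal cardinality of a member of \<open>C\<close>, as a cardinal order to be compared up to \<open>=o\<close>.
  The value for empty \<open>C\<close> is the cardinal zero, as for the infimum of the empty set of naturals.
\<close>

definition min_card :: "'a set set \<Rightarrow> 'a rel" where
  "min_card C = (if C = {} then |{}| else |SOME A. A \<in> C \<and> (\<forall>B\<in>C. |A| \<le>o |B| )| )"

lemma min_card_attained:
  assumes "C \<noteq> {}"
  shows "\<exists>A\<in>C. min_card C = |A| \<and> (\<forall>B\<in>C. |A| \<le>o |B| )"
proof -
  have "\<exists>r\<in>card_of ` C. \<forall>r'\<in>card_of ` C. r \<le>o r'"
    using assms by (intro exists_minim_Card_order) (auto simp: card_of_Card_order)
  then have "\<exists>A. A \<in> C \<and> (\<forall>B\<in>C. |A| \<le>o |B| )" by blast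
  from someI_ex[OF this] show ?thesis
    using assms by (auto simp: min_card_def)
qed

text \<open>
  Since all spaces are infinite, the union of the empty collection is not a space; the empty
  collection therefore has to be excluded, as otherwise the additivity number would always be zero.
\<close>

definition add_number :: "real set set \<Rightarrow> real set rel" where
  "add_number J = min_card {\<F>. \<F> \<noteq> {} \<and> \<F> \<subseteq> J \<and> \<Union>\<F> \<notin> J}"

definition almost_subset :: "nat set \<Rightarrow> nat set \<Rightarrow> bool" (infix "\<subseteq>*" 50) where
  "a \<subseteq>* b \<longleftrightarrow> finite (a - b)"

definition tower :: "nat set set \<Rightarrow> bool" where
  "tower T \<longleftrightarrow> (\<forall>a\<in>T. infinite a) \<and> (\<forall>a\<in>T. \<forall>b\<in>T. a \<subseteq>* b \<or> b \<subseteq>* a) \<and>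
     \<not> (\<exists>a. infinite a \<and> (\<forall>b\<in>T. a \<subseteq>* b))"

definition tower_number :: "nat set rel" where
  "tower_number = min_card {T. tower T}"

end

theory Submission
  imports Defs
begin

text \<open>
  For a sequence \<open>A\<close> of subsets of \<open>X\<close>, assign to each \<open>x\<close> in \<open>X\<close> the index set
  \<open>p x = {n. x \<in> A n}\<close>. Enumerated \<open>\<tau>\<close>-covers give sequences for which these index sets form a
  \<open>\<subseteq>*\<close>-chain of infinite sets, and a \<open>\<gamma>\<close>-subcover is an infinite pseudointersection of the chain.
  So \<open>X\<close> has the covering property iff no sequence makes the index sets a tower.

  Suppose \<open>X\<close> is a union of spaces \<open>Y\<close> with the property, and some \<open>A\<close> makes the index sets of \<open>X\<close>
  a tower. No \<open>Y\<close> is coinitial in \<open>X\<close>, since a pseudointersection for \<open>Y\<close> would then serve for \<open>X\<close>.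
  Hence each \<open>Y\<close> has a point \<open>x\<close> of \<open>X\<close> with \<open>p x\<close> below all of \<open>Y\<close>, and these \<open>p x\<close> form a tower
  with at most as many members as there are spaces \<open>Y\<close>. Conversely, a tower of minimal size, embedded
  into the Cantor set, lacks the property, and it is the union of its countable subsets
  \<open>insert x N\<close> for a fixed infinite countable \<open>N\<close>; these have the property as towers are uncountable.
\<close>

section \<open>Almost inclusion and towers\<close>

lemma almost_subset_trans:
  assumes "a \<subseteq>* b" "b \<subseteq>* c"
  shows "a \<subseteq>* c"
proof -
  have "a - c \<subseteq> (a - b) \<union> (b - c)" by blast
  then show ?thesis
    using assms unfolding almost_subset_def by (meson finite_UnI finite_subset)
qed

lemma subset_imp_almost_subset: "a \<subseteq> b \<Longrightarrow> a \<subseteq>* b"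
  by (simp add: almost_subset_def Diff_eq_empty_iff[THEN iffD2])

text \<open>Isolates the part of \<open>tower\<close> that subfamilies inherit; lacking a
  pseudointersection is not inherited.\<close>

definition almost_chain :: "nat set set \<Rightarrow> bool" where
  "almost_chain T \<longleftrightarrow> (\<forall>a\<in>T. infinite a) \<and> (\<forall>a\<in>T. \<forall>b\<in>T. a \<subseteq>* b \<or> b \<subseteq>* a)"

lemma tower_iff:
  "tower T \<longleftrightarrow> almost_chain T \<and> \<not> (\<exists>a. infinite a \<and> (\<forall>b\<in>T. a \<subseteq>* b))"
  by (auto simp: tower_def almost_chain_def)

lemma almost_chain_subset: "almost_chain T \<Longrightarrow> S \<subseteq> T \<Longrightarrow> almost_chain S"
  by (auto simp: almost_chain_def)

lemma almost_chain_finite_least: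
  assumes "finite F" "F \<noteq> {}" "almost_chain F"
  shows "\<exists>m\<in>F. \<forall>b\<in>F. m \<subseteq>* b"
  using assms
proof (induction F rule: finite_ne_induct)
  case (singleton x)
  then show ?case by (simp add: almost_subset_def)
next
  case (insert x F)
  then obtain m where m: "m \<in> F" "\<forall>b\<in>F. m \<subseteq>* b"
    using almost_chain_subset[of "insert x F" F] by blast
  have "x \<subseteq>* m \<or> m \<subseteq>* x"
    using insert.prems m by (simp add: almost_chain_def)
  moreover have "x \<subseteq>* x" by (simp add: almost_subset_def)
  ultimately show ?case
    using m almost_subset_trans by blast
qed

text \<open>An almost least member exceeds the intersection only by finitely many differences, each
  of them finite.\<close>

lemma almost_chain_finite_Inter:
  assumes "finite F" "F \<noteq> {}" "almost_chain F"
  shows "infinite (\<Inter>F)"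
proof
  assume fin: "finite (\<Inter>F)"
  obtain m where m: "m \<in> F" "\<forall>b\<in>F. m \<subseteq>* b"
    using almost_chain_finite_least[OF assms] by blast
  have "m \<subseteq> \<Inter>F \<union> (\<Union>b\<in>F. m - b)" by blast
  moreover have "finite (\<Union>b\<in>F. m - b)"
    using assms(1) m by (simp add: almost_subset_def del: UN_simps)
  ultimately have "finite m" using fin by (meson finite_UnI finite_subset)
  then show False using m assms by (auto simp: almost_chain_def)
qed

text \<open>A diagonal choice: the increasing sequence \<open>r\<close> takes its
  \<open>k\<close>-th term from the first \<open>k + 1\<close> members of an enumeration, so it is
  eventually inside each member.\<close>

lemma countable_imp_not_tower:
  assumes "countable T"
  shows "\<not> tower T"
proof
  assume T: "tower T"
  then have chain: "almost_chain T" by (simp add: tower_iff)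
  \<comment> \<open>Every infinite set is vacuously a pseudointersection of the empty
    family.\<close>
  have ne: "T \<noteq> {}" using T infinite_UNIV_nat by (auto simp: tower_def)
  define e where "e = from_nat_into T"
  have e: "range e = T" unfolding e_def using ne assms by (rule range_from_nat_into)
  have inf: "infinite (\<Inter>(e ` {..k}))" for k
    by (rule almost_chain_finite_Inter)
      (use chain e in \<open>auto intro: almost_chain_subset\<close>)
  have "\<exists>r :: nat \<Rightarrow> nat. \<forall>k. r k \<in> \<Inter>(e ` {..k}) \<and> r k < r (Suc k)"
  proof (rule dependent_nat_choice)
    show "\<exists>n. n \<in> \<Inter>(e ` {..0})"
      using inf[of 0] infinite_imp_nonempty by blast
    show "\<exists>y. y \<in> \<Inter>(e ` {..Suc k}) \<and> x < y" for x k
      using inf[of "Suc k"] infinite_nat_iff_unbounded by blast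
  qed
  then obtain r :: "nat \<Rightarrow> nat"
    where r: "\<And>k. r k \<in> \<Inter>(e ` {..k})" "\<And>k. r k < r (Suc k)" by blast
  have "inj r" using r(2) by (simp add: strict_mono_Suc_iff strict_mono_imp_inj_on)
  then have "infinite (range r)" by (simp add: finite_image_iff)
  moreover have "range r \<subseteq>* b" if b: "b \<in> T" for b
  proof -
    obtain i where i: "b = e i" using b e by auto
    have "range r - b \<subseteq> r ` {..<i}"
    proof
      fix x assume "x \<in> range r - b"
      then obtain k where k: "x = r k" "r k \<notin> e i" using i by auto
      have "k < i" using r(1)[of k] k by (meson INT_D atMost_iff not_le)
      then show "x \<in> r ` {..<i}" using k by simp
    qed
    then show ?thesis unfolding almost_subset_def by (rule finite_subset) simp
  qed
  ultimately show False using T by (auto simp: tower_def)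
qed

text \<open>Zorn gives a maximal chain. Half of a pseudointersection could be adjoined, so it would
  already be a member, yet the pseudointersection is not almost contained in it. Existence rules out
  the default value of \<open>min_card\<close> in \<open>tower_number\<close>.\<close>

lemma tower_exists: "\<exists>T. tower T"
proof -
  have "\<exists>M\<in>{T. almost_chain T}. \<forall>X\<in>{T. almost_chain T}. M \<subseteq> X \<longrightarrow> X = M"
  proof (rule subset_Zorn_nonempty)
    show "{T. almost_chain T} \<noteq> {}"
      by (auto simp: almost_chain_def intro!: exI[of _ "{}"])
    fix \<C> assume C: "\<C> \<noteq> {}" "subset.chain {T. almost_chain T} \<C>"
    have "a \<subseteq>* b \<or> b \<subseteq>* a" if "S \<in> \<C>" "R \<in> \<C>" "a \<in> S" "b \<in> R" for a b S R
    proof -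
      have "S \<subseteq> R \<or> R \<subseteq> S" "almost_chain S" "almost_chain R"
        using C that by (auto simp: subset.chain_def)
      then show ?thesis using that unfolding almost_chain_def by blast
    qed
    moreover have "infinite a" if "S \<in> \<C>" "a \<in> S" for S a
      using C that by (auto simp: subset.chain_def almost_chain_def)
    ultimately show "\<Union>\<C> \<in> {T. almost_chain T}"
      unfolding almost_chain_def by blast
  qed
  then obtain M where M: "almost_chain M" "\<And>S. almost_chain S \<Longrightarrow> M \<subseteq> S \<Longrightarrow> S = M"
    by auto
  have False if a: "infinite a" "\<forall>b\<in>M. a \<subseteq>* b" for a
  proof -
    \<comment> \<open>The terms at even positions of the increasing enumeration; those at odd
      positions keep \<open>a - c\<close> infinite.\<close>
    define c where "c = range (\<lambda>n. enumerate a (2 * n))"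
    define d where "d = range (\<lambda>n. enumerate a (2 * n + 1))"
    have "inj (enumerate a)" using strict_mono_enumerate[OF a(1)] by (rule strict_mono_imp_inj_on)
    then have "enumerate a m = enumerate a n \<longleftrightarrow> m = n" for m n by (rule inj_eq)
    then have "inj (\<lambda>n. enumerate a (2 * n))" "inj (\<lambda>n. enumerate a (2 * n + 1))" "c \<inter> d = {}"
      by (auto simp: inj_def c_def d_def) presburger
    then have "infinite c" "infinite d" "d \<subseteq> a - c" "c \<subseteq> a"
      using enumerate_in_set[OF a(1)] by (auto simp: c_def d_def finite_image_iff)
    then have c: "c \<subseteq> a" "infinite c" "infinite (a - c)" using finite_subset by blast+
    have cb: "c \<subseteq>* b" if "b \<in> M" for b
      using a(2) that subset_imp_almost_subset[OF c(1)] almost_subset_trans by blast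
    have "almost_chain (insert c M)"
      using M(1) cb c(2) by (auto simp: almost_chain_def almost_subset_def)
    then have "c \<in> M" using M(2)[of "insert c M"] by blast
    then show False using a(2) c(3) by (auto simp: almost_subset_def)
  qed
  then show ?thesis using M(1) tower_iff by blast
qed

lemma tower_number_attained:
  "\<exists>T. tower T \<and> tower_number = |T| \<and> (\<forall>S. tower S \<longrightarrow> |T| \<le>o |S| )"
  unfolding tower_number_def using min_card_attained[of "{T. tower T}"] tower_exists by auto

section \<open>Embedding sets of naturals into the reals\<close>

text \<open>Ternary expansions with digits 0 and 1; the range is the Cantor set scaled by
  3/2.\<close>

definition cantor_code :: "nat set \<Rightarrow> real" where
  "cantor_code a = (\<Sum>n. indicator a n * (1/3) ^ n)"

lemma cantor_code_summable: "summable (\<lambda>n. indicator a n * (1/3::real) ^ n)"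
  by (rule summable_comparison_test'[where g = "\<lambda>n. (1/3) ^ n" and N = 0])
    (auto simp: indicator_def intro: summable_geometric)

text \<open>The digit at \<open>m\<close> contributes \<open>(1/3) ^ m\<close>, and all later digits
  together cancel at most half of it.\<close>

lemma cantor_code_dist_first:
  assumes "\<And>i. i < m \<Longrightarrow> i \<in> a \<longleftrightarrow> i \<in> b" and "m \<in> a" "m \<notin> b"
  shows "(1/3) ^ m / 2 \<le> cantor_code a - cantor_code b"
proof -
  define d where "d n = (indicator a n - indicator b n) * (1/3::real) ^ n" for n
  have d: "summable d" "cantor_code a - cantor_code b = suminf d"
    using suminf_diff[OF cantor_code_summable cantor_code_summable, of a b]
      summable_diff[OF cantor_code_summable cantor_code_summable, of a b]
    by (simp_all add: d_def[abs_def] cantor_code_def algebra_simps)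
  have "(\<Sum>i<Suc m. d i) = (1/3) ^ m"
    using assms by (simp add: d_def indicator_def)
  then have split: "suminf d = (\<Sum>n. d (n + Suc m)) + (1/3) ^ m"
    using suminf_split_initial_segment[OF d(1), of "Suc m"] by simp
  have geo: "(\<lambda>n. - ((1/3::real) ^ Suc m * (1/3) ^ n)) sums - ((1/3) ^ Suc m * (1 / (1 - 1/3)))"
    by (intro sums_minus sums_mult geometric_sums) simp
  have "- ((1/3) ^ Suc m * (1 / (1 - 1/3))) \<le> (\<Sum>n. d (n + Suc m))"
  proof (rule sums_le[OF _ geo summable_sums])
    show "summable (\<lambda>n. d (n + Suc m))" using d(1) by (simp only: summable_iff_shift)
    show "- ((1/3) ^ Suc m * (1/3) ^ n) \<le> d (n + Suc m)" for n
      by (auto simp: d_def indicator_def power_add)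
  qed
  then show ?thesis using split d(2) by simp
qed

text \<open>The first difference occurs at or before \<open>n\<close>. As the gap depends on
  \<open>n\<close> alone, membership of \<open>n\<close> is locally constant on codes.\<close>

lemma cantor_code_dist:
  assumes "n \<in> a \<longleftrightarrow> n \<notin> b"
  shows "(1/3) ^ n / 2 \<le> \<bar>cantor_code a - cantor_code b\<bar>"
proof -
  define m where "m = (LEAST i. (i \<in> a) \<noteq> (i \<in> b))"
  have m: "(m \<in> a) \<noteq> (m \<in> b)"
    unfolding m_def by (rule LeastI[of _ n]) (use assms in simp)
  have less: "\<And>i. i < m \<Longrightarrow> i \<in> a \<longleftrightarrow> i \<in> b"
    unfolding m_def using not_less_Least by blast
  have "m \<le> n" unfolding m_def by (rule Least_le) (use assms in simp)
  then have "(1/3::real) ^ n \<le> (1/3) ^ m" by (intro power_decreasing) auto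
  moreover have "(1/3) ^ m / 2 \<le> \<bar>cantor_code a - cantor_code b\<bar>"
  proof (cases "m \<in> a")
    case True
    then have "(1/3) ^ m / 2 \<le> cantor_code a - cantor_code b"
      using m less by (intro cantor_code_dist_first) auto
    then show ?thesis by linarith
  next
    case False
    then have "(1/3) ^ m / 2 \<le> cantor_code b - cantor_code a"
      using m less by (intro cantor_code_dist_first) auto
    then show ?thesis by linarith
  qed
  ultimately show ?thesis by linarith
qed

lemma inj_cantor_code: "inj cantor_code"
proof (rule injI, rule ccontr)
  fix a b assume eq: "cantor_code a = cantor_code b" and "a \<noteq> b"
  then obtain n where "n \<in> a \<longleftrightarrow> n \<notin> b" by blast
  from cantor_code_dist[OF this] eq have "(1/3::real) ^ n \<le> 0" by simp
  moreover have "(0::real) < (1/3) ^ n" by simp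
  ultimately show False by linarith
qed

lemma openin_cantor_code:
  "openin (top_of_set (cantor_code ` T)) (cantor_code ` {a\<in>T. n \<in> a})"
  unfolding openin_euclidean_subtopology_iff
proof (intro conjI ballI)
  fix x assume "x \<in> cantor_code ` {a\<in>T. n \<in> a}"
  then obtain a where a: "x = cantor_code a" "n \<in> a" by auto
  have "y \<in> cantor_code ` {a\<in>T. n \<in> a}"
    if y: "y \<in> cantor_code ` T" "dist y x < (1/3) ^ n / 2" for y
  proof -
    obtain b where b: "b \<in> T" "y = cantor_code b" using y by auto
    have "n \<in> b" using cantor_code_dist[of n b a] a b y by (auto simp: dist_real_def)
    then show ?thesis using b by auto
  qed
  then show "\<exists>e>0. \<forall>y\<in>cantor_code ` T. dist y x < e \<longrightarrow> y \<in> cantor_code ` {a\<in>T. n \<in> a}"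
    by (intro exI[of _ "(1/3) ^ n / 2"]) auto
qed blast

section \<open>Covering properties in terms of towers\<close>

definition index_sets :: "'a set \<Rightarrow> (nat \<Rightarrow> 'a set) \<Rightarrow> nat set set" where
  "index_sets X A = (\<lambda>x. {n. x \<in> A n}) ` X"

text \<open>
  As \<open>A\<close> may repeat values, largeness is the point: if only finitely many members contain \<open>x\<close>,
  those taken infinitely often form a chain, and a point \<open>y\<close> outside the largest one has an index
  set almost disjoint from that of \<open>x\<close>.
\<close>

lemma range_tau_cover:
  assumes chain: "almost_chain (index_sets X A)"
    and sub: "\<And>n. A n \<subseteq> X"
    and fin: "finite {n. A n = X}"
  shows "tau_cover X (range A - {X})"
proof -
  define p where "p x = {n. x \<in> A n}" for x
  have inf: "infinite (p x)" if "x \<in> X" for x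
    using chain that unfolding almost_chain_def index_sets_def p_def by blast
  have lin: "p x \<subseteq>* p y \<or> p y \<subseteq>* p x" if "x \<in> X" "y \<in> X" for x y
    using chain that unfolding almost_chain_def index_sets_def p_def by blast
  have large: "infinite {U \<in> range A - {X}. x \<in> U}" if x: "x \<in> X" for x
  proof
    assume fin_x: "finite {U \<in> range A - {X}. x \<in> U}" (is "finite ?R")
    define K where "K = {U \<in> ?R. infinite {n. A n = U}}"
    \<comment> \<open>The indices whose value is \<open>X\<close> or a member containing
      \<open>x\<close> that is taken only finitely often; the rest of \<open>p x\<close> has values
      in \<open>K\<close>.\<close>
    define N where "N = (\<Union>U\<in>?R - K. {n. A n = U}) \<union> {n. A n = X}"
    have finN: "finite N" using fin_x fin by (auto simp: N_def K_def)
    have px: "p x \<subseteq> N \<union> {n. A n \<in> K}" by (auto simp: N_def p_def)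
    have K: "finite K" unfolding K_def using fin_x by (rule rev_finite_subset) blast
    have "K \<noteq> {}"
    proof
      assume "K = {}"
      then have "p x \<subseteq> N" using px by simp
      then show False using finN inf[OF x] finite_subset by blast
    qed
    then obtain U where U: "U \<in> K" "\<And>V. V \<in> K \<Longrightarrow> U \<subseteq> V \<Longrightarrow> U = V"
      using finite_has_maximal[OF K] by blast
    have max: "V \<subseteq> U" if V: "V \<in> K" for V
    proof (rule ccontr)
      assume "\<not> V \<subseteq> U"
      moreover from this have "\<not> U \<subseteq> V" using U(2)[OF V] by blast
      ultimately obtain v u where vu: "v \<in> V" "v \<notin> U" "u \<in> U" "u \<notin> V" by blast
      have "{n. A n = U} \<subseteq> p u - p v" "{n. A n = V} \<subseteq> p v - p u"
        using vu by (auto simp: p_def)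
      then have "infinite (p u - p v)" "infinite (p v - p u)"
        using U(1) V unfolding K_def by (auto dest: finite_subset)
      moreover have "u \<in> X" "v \<in> X" using U(1) V vu sub by (auto simp: K_def)
      ultimately show False using lin[of u v] by (auto simp: almost_subset_def)
    qed
    obtain y where y: "y \<in> X" "y \<notin> U" using U(1) sub by (auto simp: K_def)
    have "p x \<inter> p y \<subseteq> N" using px max y(2) by (auto simp: p_def)
    then have finxy: "finite (p x \<inter> p y)" using finN finite_subset by blast
    have "p x = (p x \<inter> p y) \<union> (p x - p y)" "p y = (p x \<inter> p y) \<union> (p y - p x)" by auto
    then show False
      using lin[OF x y(1)] inf[OF x] inf[OF y(1)] finxy
      unfolding almost_subset_def by (metis finite_UnI)
  qed
  have tau: "finite {U \<in> range A - {X}. \<not> (x \<in> U \<longrightarrow> y \<in> U)}" if "p x \<subseteq>* p y" for x y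
  proof -
    have "{U \<in> range A - {X}. \<not> (x \<in> U \<longrightarrow> y \<in> U)} \<subseteq> A ` (p x - p y)"
      by (auto simp: p_def)
    then show ?thesis using that unfolding almost_subset_def by (meson finite_imageI finite_subset)
  qed
  have "x \<in> \<Union>(range A - {X})" if "x \<in> X" for x
    using infinite_imp_nonempty[OF large[OF that]] by auto
  then have "\<Union>(range A - {X}) = X" using sub by blast
  then have "large_cover X (range A - {X})"
    using large by (simp add: large_cover_def cover_def)
  then show ?thesis
    unfolding tau_cover_def by (intro conjI ballI) (use lin tau in blast)+
qed

text \<open>Choose one index for each member of the subcover. Distinct members get distinct indices,
  and only the finitely many members missing a point give indices outside its index set.\<close>

lemma gamma_subcover_imp_pseudointersection:
  assumes "\<V> \<subseteq> range A" "gamma_cover X \<V>"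
  shows "\<exists>a. infinite a \<and> (\<forall>b\<in>index_sets X A. a \<subseteq>* b)"
proof -
  define g where "g = inv_into UNIV A"
  have g: "A (g V) = V" if "V \<in> \<V>" for V
    unfolding g_def using that assms(1) by (meson f_inv_into_f subsetD)
  then have "inj_on g \<V>" by (metis inj_onI)
  then have "infinite (g ` \<V>)"
    using assms(2) by (simp add: finite_image_iff gamma_cover_def)
  moreover have "g ` \<V> \<subseteq>* b" if "b \<in> index_sets X A" for b
  proof -
    obtain x where x: "x \<in> X" "b = {n. x \<in> A n}" using \<open>b \<in> index_sets X A\<close>
      by (auto simp: index_sets_def)
    have "g ` \<V> - b \<subseteq> g ` {V \<in> \<V>. x \<notin> V}" using x g by auto
    moreover have "finite {V \<in> \<V>. x \<notin> V}" using assms(2) x by (simp add: gamma_cover_def)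
    ultimately show ?thesis unfolding almost_subset_def by (meson finite_imageI finite_subset)
  qed
  ultimately show ?thesis by blast
qed

text \<open>Since the enumeration is injective, finitely many members have only finitely many
  indices.\<close>

lemma tau_cover_index_sets:
  assumes "tau_cover X \<U>" and e: "bij_betw e UNIV \<U>"
  shows "almost_chain (index_sets X e)"
proof -
  have inj: "inj e" and rng: "range e = \<U>"
    using e by (auto simp: bij_betw_def)
  have "infinite {n. x \<in> e n}" if "x \<in> X" for x
  proof -
    have "{U \<in> \<U>. x \<in> U} = e ` {n. x \<in> e n}" using rng by auto
    then show ?thesis
      using assms(1) that unfolding tau_cover_def large_cover_def by (metis finite_imageI)
  qed
  moreover have "{n. x \<in> e n} \<subseteq>* {n. y \<in> e n}"
    if "finite {U \<in> \<U>. \<not> (x \<in> U \<longrightarrow> y \<in> U)}" for x y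
  proof -
    have "{n. x \<in> e n} - {n. y \<in> e n} = e -` {U \<in> \<U>. \<not> (x \<in> U \<longrightarrow> y \<in> U)}" using rng by auto
    then show ?thesis using finite_vimageI[OF that inj] by (simp only: almost_subset_def)
  qed
  ultimately show ?thesis
    using assms(1) unfolding almost_chain_def index_sets_def tau_cover_def by blast
qed

text \<open>Covering comes for free: a point outside the union would be missed by infinitely many
  members.\<close>

lemma pseudointersection_gamma_cover:
  assumes cover: "cover X \<U>" and e: "bij_betw e UNIV \<U>"
    and a: "infinite a" "\<forall>b\<in>index_sets X e. a \<subseteq>* b"
  shows "gamma_cover X (e ` a)"
proof -
  have inj: "inj e" and rng: "range e = \<U>" using e by (auto simp: bij_betw_def)
  have inf: "infinite (e ` a)"
    using a(1) inj by (meson finite_imageD inj_on_subset subset_UNIV)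
  have fin: "finite {U \<in> e ` a. x \<notin> U}" if "x \<in> X" for x
  proof -
    have "{U \<in> e ` a. x \<notin> U} = e ` (a - {n. x \<in> e n})" by auto
    then show ?thesis using a(2) that by (auto simp: index_sets_def almost_subset_def)
  qed
  have "x \<in> \<Union>(e ` a)" if x: "x \<in> X" for x
  proof (rule ccontr)
    assume "x \<notin> \<Union>(e ` a)"
    then have "{U \<in> e ` a. x \<notin> U} = e ` a" by auto
    then show False using fin[OF x] inf by simp
  qed
  moreover have "\<Union>(e ` a) \<subseteq> X" "X \<notin> e ` a" using cover rng by (auto simp: cover_def)
  ultimately have "cover X (e ` a)" by (auto simp: cover_def)
  then show ?thesis using inf fin by (simp add: gamma_cover_def)
qed

text \<open>Open and Borel sets enter only through these facts: traces handle subspaces, and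
  relatively open sets suffice for the example built from a tower.\<close>

locale relative_sets =
  fixes P :: "real set \<Rightarrow> real set set"
  assumes subset_space: "U \<in> P X \<Longrightarrow> U \<subseteq> X"
    and trace: "U \<in> P X \<Longrightarrow> Y \<subseteq> X \<Longrightarrow> U \<inter> Y \<in> P Y"
    and open_mem: "openin (top_of_set X) U \<Longrightarrow> U \<in> P X"
begin

definition property :: "real set set" where
  "property = cov_binom (\<lambda>X. {\<U>. countable \<U> \<and> (\<forall>U\<in>\<U>. U \<in> P X) \<and> tau_cover X \<U>})
     (\<lambda>X. {\<U>. countable \<U> \<and> (\<forall>U\<in>\<U>. U \<in> P X) \<and> gamma_cover X \<U>})"

text \<open>Allowing arbitrary sequences, with repetitions or the value \<open>X\<close>, makes the
  criterion applicable to traces on subspaces, where members may coincide or become the whole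
  space.\<close>

lemma property_iff:
  "X \<in> property \<longleftrightarrow> infinite X \<and> (\<forall>A. (\<forall>n. A n \<in> P X) \<longrightarrow> \<not> tower (index_sets X A))"
proof (intro iffI conjI allI impI)
  assume X: "X \<in> property"
  then show "infinite X" by (simp add: property_def cov_binom_def)
  fix A :: "nat \<Rightarrow> real set" assume A: "\<forall>n. A n \<in> P X"
  show "\<not> tower (index_sets X A)"
  proof
    assume T: "tower (index_sets X A)"
    \<comment> \<open>Indices with value \<open>X\<close> lie in every index set, so infinitely many
      of them would form a pseudointersection.\<close>
    have "{n. A n = X} \<subseteq>* b" if "b \<in> index_sets X A" for b
      using that by (intro subset_imp_almost_subset) (auto simp: index_sets_def)
    then have "finite {n. A n = X}" using T unfolding tower_iff by blast
    then have "tau_cover X (range A - {X})"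
      using T A subset_space by (intro range_tau_cover) (auto simp: tower_iff)
    moreover have "countable (range A - {X})" "\<forall>U\<in>range A - {X}. U \<in> P X" using A by auto
    ultimately obtain \<V> where "\<V> \<subseteq> range A - {X}" "gamma_cover X \<V>"
      using X unfolding property_def cov_binom_def by blast
    then have "\<exists>a. infinite a \<and> (\<forall>b\<in>index_sets X A. a \<subseteq>* b)"
      by (intro gamma_subcover_imp_pseudointersection) auto
    then show False using T by (simp add: tower_iff)
  qed
next
  assume X: "infinite X \<and> (\<forall>A. (\<forall>n. A n \<in> P X) \<longrightarrow> \<not> tower (index_sets X A))"
  have "\<exists>\<V>. \<V> \<subseteq> \<U> \<and> countable \<V> \<and> (\<forall>U\<in>\<V>. U \<in> P X) \<and> gamma_cover X \<V>"
    if U: "countable \<U>" "\<forall>U\<in>\<U>. U \<in> P X" "tau_cover X \<U>" for \<U>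
  proof -
    obtain x where "x \<in> X" using X infinite_imp_nonempty by blast
    then have "infinite {U \<in> \<U>. x \<in> U}" using U(3) by (simp add: tau_cover_def large_cover_def)
    then have "infinite \<U>" using finite_Collect_conjI[of "\<lambda>U. U \<in> \<U>"] by auto
    then have e: "bij_betw (from_nat_into \<U>) UNIV \<U>"
      using U(1) by (rule bij_betw_from_nat_into[rotated])
    then have "from_nat_into \<U> n \<in> P X" for n using U(2) by (auto simp: bij_betw_def)
    then have "\<not> tower (index_sets X (from_nat_into \<U>))" using X by blast
    then obtain a where a: "infinite a" "\<forall>b\<in>index_sets X (from_nat_into \<U>). a \<subseteq>* b"
      using tau_cover_index_sets[OF U(3) e] by (auto simp: tower_iff)
    have "gamma_cover X (from_nat_into \<U> ` a)"
      by (rule pseudointersection_gamma_cover[OF _ e a])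
        (use U(3) in \<open>simp add: tau_cover_def large_cover_def\<close>)
    moreover have "from_nat_into \<U> ` a \<subseteq> \<U>" using e by (auto simp: bij_betw_def)
    ultimately show ?thesis using U by (meson countable_subset subsetD)
  qed
  then show "X \<in> property" using X by (auto simp: property_def cov_binom_def)
qed

lemma countable_imp_property:
  assumes "countable X" "infinite X"
  shows "X \<in> property"
  unfolding property_iff index_sets_def
  by (intro conjI allI impI assms countable_imp_not_tower countable_image)

text \<open>This gives the lower bound for the additivity number.\<close>

lemma tower_le_bad_union:
  assumes F: "\<F> \<noteq> {}" "\<F> \<subseteq> property" "\<Union>\<F> \<notin> property"
  shows "\<exists>T. tower T \<and> |T| \<le>o |\<F>|"
proof -
  have "infinite (\<Union>\<F>)"
    using F(1,2) by (metis Sup_upper ex_in_conv finite_subset property_iff subsetD)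
  then obtain A where A: "\<And>n. A n \<in> P (\<Union>\<F>)" and T: "tower (index_sets (\<Union>\<F>) A)"
    using F(3) unfolding property_iff by blast
  define p where "p x = {n. x \<in> A n}" for x
  have p: "index_sets Z A = p ` Z" for Z by (simp add: index_sets_def p_def)
  have lin: "p x \<subseteq>* p y \<or> p y \<subseteq>* p x" if "x \<in> \<Union>\<F>" "y \<in> \<Union>\<F>" for x y
    using T that unfolding p tower_def by blast
  have "\<exists>x\<in>\<Union>\<F>. \<forall>y\<in>Y. p x \<subseteq>* p y" if Y: "Y \<in> \<F>" for Y
  proof (rule ccontr)
    assume neg: "\<not> (\<exists>x\<in>\<Union>\<F>. \<forall>y\<in>Y. p x \<subseteq>* p y)"
    have "A n \<inter> Y \<in> P Y" for n using A Y by (intro trace) auto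
    moreover have "Y \<in> property" using F(2) Y by blast
    ultimately have "\<not> tower (index_sets Y (\<lambda>n. A n \<inter> Y))" by (simp add: property_iff)
    \<comment> \<open>Passing to traces leaves the index sets of points of \<open>Y\<close>
      unchanged.\<close>
    moreover have "index_sets Y (\<lambda>n. A n \<inter> Y) = p ` Y" by (auto simp: index_sets_def p_def)
    moreover have "almost_chain (p ` Y)"
      by (rule almost_chain_subset[of "p ` \<Union>\<F>"]) (use T Y p in \<open>auto simp: tower_iff\<close>)
    ultimately obtain a where a: "infinite a" "\<forall>y\<in>Y. a \<subseteq>* p y" by (auto simp: tower_iff)
    have "a \<subseteq>* p x" if x: "x \<in> \<Union>\<F>" for x
    proof -
      obtain y where "y \<in> Y" "\<not> p x \<subseteq>* p y" using neg x by blast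
      moreover have "p y \<subseteq>* p x" using lin[of x y] calculation x Y by blast
      ultimately show ?thesis using a(2) almost_subset_trans by blast
    qed
    then show False using T a(1) unfolding tower_iff p by blast
  qed
  then obtain h where h: "\<And>Y. Y \<in> \<F> \<Longrightarrow> h Y \<in> \<Union>\<F>"
    "\<And>Y y. Y \<in> \<F> \<Longrightarrow> y \<in> Y \<Longrightarrow> p (h Y) \<subseteq>* p y" by metis
  have "tower ((\<lambda>Y. p (h Y)) ` \<F>)"
    unfolding tower_iff
  proof
    show "almost_chain ((\<lambda>Y. p (h Y)) ` \<F>)"
      by (rule almost_chain_subset[of "p ` \<Union>\<F>"]) (use T p h(1) in \<open>auto simp: tower_iff\<close>)
    show "\<nexists>a. infinite a \<and> (\<forall>b\<in>(\<lambda>Y. p (h Y)) ` \<F>. a \<subseteq>* b)"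
    proof
      assume "\<exists>a. infinite a \<and> (\<forall>b\<in>(\<lambda>Y. p (h Y)) ` \<F>. a \<subseteq>* b)"
      then obtain a where a: "infinite a" "\<And>Y. Y \<in> \<F> \<Longrightarrow> a \<subseteq>* p (h Y)" by blast
      then have "a \<subseteq>* p x" if "x \<in> \<Union>\<F>" for x
        using that h(2) almost_subset_trans by blast
      then show False using T a(1) unfolding tower_iff p by blast
    qed
  qed
  then show ?thesis using card_of_image[of "\<lambda>Y. p (h Y)" \<F>] by (intro exI conjI)
qed

text \<open>This gives the upper bound: on the codes of \<open>T\<close>, the sets
  \<open>A n\<close> return \<open>T\<close> itself as the family of index sets.\<close>

lemma bad_union_le_tower:
  assumes T: "tower T"
  shows "\<exists>\<F>. \<F> \<noteq> {} \<and> \<F> \<subseteq> property \<and> \<Union>\<F> \<notin> property \<and> |\<F>| \<le>o |T|"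
proof -
  define X where "X = cantor_code ` T"
  define A where "A n = cantor_code ` {a\<in>T. n \<in> a}" for n
  have "{n. cantor_code a \<in> A n} = a" if "a \<in> T" for a
    using that by (auto simp: A_def inj_image_mem_iff[OF inj_cantor_code])
  then have "index_sets X A = T" by (simp add: index_sets_def X_def image_image)
  moreover have "A n \<in> P X" for n unfolding A_def X_def by (intro open_mem openin_cantor_code)
  ultimately have X: "X \<notin> property" using T by (auto simp: property_iff)
  have "infinite T" using T countable_imp_not_tower countable_finite by blast
  then have "infinite X"
    unfolding X_def using inj_cantor_code by (meson finite_imageD inj_on_subset subset_UNIV)
  \<comment> \<open>Adjoining \<open>N\<close> makes each piece infinite, as a space must be, while
    keeping it countable.\<close>
  then obtain N where N: "countable N" "infinite N" "N \<subseteq> X"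
    using infinite_countable_subset' by blast
  define \<F> where "\<F> = (\<lambda>x. insert x N) ` X"
  have "\<F> \<subseteq> property" using N by (auto simp: \<F>_def intro!: countable_imp_property)
  moreover have "\<Union>\<F> = X" using N by (auto simp: \<F>_def)
  moreover have "\<F> \<noteq> {}" using N by (auto simp: \<F>_def)
  moreover have "|\<F>| \<le>o |T|"
    unfolding \<F>_def X_def by (rule ordLeq_transitive[OF card_of_image card_of_image])
  ultimately show ?thesis using X by metis
qed

lemma add_number_property: "add_number property =o tower_number"
proof -
  obtain T where T: "tower T" "tower_number = |T|" "\<And>S. tower S \<Longrightarrow> |T| \<le>o |S|"
    using tower_number_attained by blast
  define C where "C = {\<F>. \<F> \<noteq> {} \<and> \<F> \<subseteq> property \<and> \<Union>\<F> \<notin> property}"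
  have add: "add_number property = min_card C" by (simp add: add_number_def C_def)
  obtain \<G> where G: "\<G> \<in> C" "|\<G>| \<le>o |T|"
    using bad_union_le_tower[OF T(1)] unfolding C_def by blast
  \<comment> \<open>Only for nonempty \<open>C\<close> is \<open>min_card\<close> a true
    minimum.\<close>
  then have "C \<noteq> {}" by blast
  then obtain \<F> where F: "\<F> \<in> C" "add_number property = |\<F>|" "\<And>\<H>. \<H> \<in> C \<Longrightarrow> |\<F>| \<le>o |\<H>|"
    using min_card_attained[of C] add by auto
  have "|\<F>| \<le>o |T|" using F(3)[OF G(1)] G(2) by (rule ordLeq_transitive)
  moreover have "|T| \<le>o |\<F>|"
  proof -
    obtain S where S: "tower S" "|S| \<le>o |\<F>|"
      using tower_le_bad_union[of \<F>] F(1) unfolding C_def by blast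
    show ?thesis using T(3)[OF S(1)] S(2) by (rule ordLeq_transitive)
  qed
  ultimately show ?thesis using F(2) T(2) by (simp add: ordIso_iff_ordLeq)
qed

end

section \<open>Specialization to open and Borel covers\<close>

interpretation open_sets: relative_sets "\<lambda>X. {U. openin (top_of_set X) U}"
proof
  show "U \<inter> Y \<in> {U. openin (top_of_set Y) U}"
    if "U \<in> {U. openin (top_of_set X) U}" "Y \<subseteq> X" for U X Y :: "real set"
    using that by (auto simp: openin_open)
qed (auto dest: openin_imp_subset)

interpretation borel_sets: relative_sets "\<lambda>X. sets (restrict_space borel X)"
proof
  show "U \<inter> Y \<in> sets (restrict_space borel Y)"
    if "U \<in> sets (restrict_space borel X)" "Y \<subseteq> X" for U X Y :: "real set"
    using that by (auto simp: sets_restrict_space)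
  show "U \<in> sets (restrict_space borel X)" if "openin (top_of_set X) U" for U X :: "real set"
    using that by (auto simp: sets_restrict_space openin_open)
qed (auto simp: sets_restrict_space)

theorem theorem5p5:
  shows "add_number (cov_binom Borel_Tau Borel_Gamma) =o add_number (cov_binom Open_Tau Open_Gamma)
       \<and> add_number (cov_binom Open_Tau Open_Gamma) =o tower_number"
proof -
  have "open_sets.property = cov_binom Open_Tau Open_Gamma"
    by (simp add: open_sets.property_def Open_Tau_def[abs_def] Open_Gamma_def[abs_def])
  moreover have "borel_sets.property = cov_binom Borel_Tau Borel_Gamma"
    by (simp add: borel_sets.property_def Borel_Tau_def[abs_def] Borel_Gamma_def[abs_def])
  ultimately show ?thesis
    using open_sets.add_number_property borel_sets.add_number_property
    by (metis ordIso_symmetric ordIso_transitive)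
qed

end
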